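(* Let $I\subset\mathbb{R}$ be an open interval, let $a,b\in I$ with $a<b$, and let $f:I\to\mathbb{R}$ be a twice differentiable mapping such that $f'':I\to\mathbb{R}$ is integrable. Let $q\ge 1$ and $0\le\lambda\le 1$, and suppose that $|f''|^{q}$ belongs to the class $Q(I)$. Then the following hold. If $0\le\lambda\le\frac12$, then $$\left|(\lambda-1)f\left(\frac{a+b}{2}\right)-\lambda\frac{f(a)+f(b)}{2}+\frac{1}{b-a}\int_a^b f(x)\,dx\right|$$ $$\le \frac{(b-a)^2}{2}\left(\frac{\lambda^3}{3}+\frac{1-3\lambda}{24}\right)^{1-\frac1q}\Bigg\{\left(\left[\lambda^2-\frac{4\lambda-1}{8}\right]|f''(a)|^q+\left[\ln\left(\left(2(1-\lambda)^2\right)^{1-\lambda}\right)+\frac{20\lambda-8\lambda^2-5}{8}\right]|f''(b)|^q\right)^{\frac1q}$$ $$+\left(\left[\ln\left(\left(2(1-\lambda)^2\right)^{1-\lambda}\right)+\frac{20\lambda-8\lambda^2-5}{8}\right]|f''(a)|^q+\left[\lambda^2-\frac{4\lambda-1}{8}\right]|f''(b)|^q\right)^{\frac1q}\Bigg\}.$$ If $\frac12\le\lambda\le1$, then $$\left|(\lambda-1)f\left(\frac{a+b}{2}\right)-\lambda\frac{f(a)+f(b)}{2}+\frac{1}{b-a}\int_a^b f(x)\,dx\right|$$ $$\le \frac{(b-a)^2}{2}\left(\frac{3\lambda-1}{24}\right)^{1-\frac1q}\Bigg\{\left(\frac{4\lambda-1}{8}|f''(a)|^q+\left[\frac{5-4\lambda}{8}-(\lambda-1)\ln\frac12\right]|f''(b)|^q\right)^{\frac1q}$$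 $$+\left(\left[\frac{5-4\lambda}{8}-(\lambda-1)\ln\frac12\right]|f''(a)|^q+\frac{4\lambda-1}{8}|f''(b)|^q\right)^{\frac1q}\Bigg\}.$$
   Context: Godunova–Levin class $Q(I)$: a map $g:I\to\mathbb{R}$ belongs to $Q(I)$ if it is nonnegative and for all $x,y\in I$ and $\lambda\in(0,1)$ it satisfies $g(\lambda x+(1-\lambda)y)\le \frac{g(x)}{\lambda}+\frac{g(y)}{1-\lambda}$. *)

theory Defs
  imports "HOL-Analysis.Analysis"
begin

definition godunova_levin :: "real set \<Rightarrow> (real \<Rightarrow> real) set" where
  "godunova_levin I =
    {g. (\<forall>x\<in>I. 0 \<le> g x) \<and>
        (\<forall>x\<in>I. \<forall>y\<in>I. \<forall>t\<in>{0<..<1}.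
           g (t * x + (1 - t) * y) \<le> g x / t + g y / (1 - t))}"

end

theory Submission
  imports Defs
begin

text \<open>
  Write \<open>E\<close> for the expression inside the absolute value and \<open>m\<close> for the midpoint of
  \<open>a\<close> and \<open>b\<close>. For \<open>x\<close>, \<open>y\<close> being \<open>a\<close>, \<open>b\<close> in either order put
  \<open>J x y = \<integral>\<^sub>0\<^sup>1\<^sup>/\<^sup>2 t (t - l) f''(t x + (1 - t) y) dt\<close>. The integrand is a derivative: integrating
  by parts twice, which moves both derivatives onto the quadratic \<open>t (t - l)\<close>, expresses \<open>(x - y)\<^sup>2 J x y\<close> by
  the values of \<open>f'\<close> at \<open>m\<close>, of \<open>f\<close> at \<open>m\<close> and \<open>y\<close>, and the mean of \<open>f\<close> between \<open>m\<close> and \<open>y\<close>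
  (\<open>half_kernel_has_integral\<close>). In \<open>J a b + J b a\<close> the two terms with \<open>f' m\<close> cancel, the
  two half means combine, and \<open>2 E = (b - a)\<^sup>2 (J a b + J b a)\<close>.

  It remains to bound each \<open>J\<close>. The Godunova-Levin condition gives the pointwise bound
  \<open>\<bar>f''(t x + (1 - t) y)\<bar>\<^sup>q \<le> \<bar>f'' x\<bar>\<^sup>q / t + \<bar>f'' y\<bar>\<^sup>q / (1 - t)\<close>, and the power mean inequality for
  the weight \<open>t \<bar>t - l\<bar>\<close> (\<open>power_mean_bound\<close>) turns it into
  \<open>\<bar>J x y\<bar> \<le> W\<^sup>1\<^sup>-\<^sup>1\<^sup>/\<^sup>q (P \<bar>f'' x\<bar>\<^sup>q + R \<bar>f'' y\<bar>\<^sup>q)\<^sup>1\<^sup>/\<^sup>q\<close>, where \<open>W\<close>, \<open>P\<close> and \<open>R\<close> are the integrals over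
  \<open>[0, 1/2]\<close> of \<open>t \<bar>t - l\<bar>\<close>, \<open>\<bar>t - l\<bar>\<close> and \<open>t \<bar>t - l\<bar> / (1 - t)\<close>. The factor \<open>t\<close> in the weight cancels the
  singularity of \<open>1 / t\<close>. The two cases of the theorem are the two evaluations of these integrals,
  according to whether \<open>t - l\<close> changes sign in \<open>[0, 1/2]\<close>.
\<close>

section \<open>The power mean inequality\<close>

text \<open>
  The tangent line to the concave map \<open>x \<mapsto> x\<^sup>1\<^sup>/\<^sup>q\<close> at \<open>c\<close> lies above the graph; this is Young's
  inequality for \<open>h\<close> and \<open>c\<close> with weights \<open>1 / q\<close> and \<open>1 - 1 / q\<close>.
\<close>
lemma powr_inverse_le_tangent:
  fixes h c q :: real
  assumes "0 \<le> h" "0 < c" "1 \<le> q"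
  shows "h powr (1 / q) \<le> c powr (1 / q) * (1 - 1 / q + h / (q * c))"
proof (cases "h = 0")
  case True
  then show ?thesis using assms by simp
next
  case False
  have "h powr (1 / q) * c powr (1 - 1 / q) \<le> (1 / q) * h + (1 - 1 / q) * c"
    using assms False by (intro Youngs_inequality_0) auto
  then have "h powr (1 / q) \<le> ((1 / q) * h + (1 - 1 / q) * c) / c powr (1 - 1 / q)"
    using assms by (simp add: field_simps)
  also have "c powr (1 - 1 / q) = c / c powr (1 / q)"
    using assms by (simp add: powr_diff)
  also have "((1 / q) * h + (1 - 1 / q) * c) / (c / c powr (1 / q))
      = c powr (1 / q) * (1 - 1 / q + h / (q * c))"
    using assms by (simp add: field_simps)
  finally show ?thesis .
qed

text \<open>
  The power mean inequality for a weight \<open>w\<close>, in the form in which \<open>v\<close> is only dominated by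
  \<open>w h\<^sup>1\<^sup>/\<^sup>q\<close>. Bounding \<open>h\<^sup>1\<^sup>/\<^sup>q\<close> by its tangent line at \<open>c\<close> leaves only the integrals of \<open>w\<close> and
  \<open>w h\<close>, which have closed forms in the application. The best choice is the weighted mean
  \<open>c = H / W\<close>; as it may be zero, where there is no tangent, it is approached from above.
\<close>
lemma power_mean_bound:
  fixes v w h :: "real \<Rightarrow> real" and q :: real
  assumes v: "(v has_integral J) S" and w: "(w has_integral W) S" and "0 < W"
    and wh: "((\<lambda>t. w t * h t) has_integral H) S"
    and q: "1 \<le> q"
    and w0: "\<And>t. t \<in> S \<Longrightarrow> 0 \<le> w t" and h0: "\<And>t. t \<in> S \<Longrightarrow> 0 \<le> h t"
    and le: "\<And>t. t \<in> S \<Longrightarrow> \<bar>v t\<bar> \<le> w t * h t powr (1 / q)"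
  shows "\<bar>J\<bar> \<le> W powr (1 - 1 / q) * H powr (1 / q)"
proof -
  have H0: "0 \<le> H"
    using wh by (rule has_integral_nonneg) (simp add: w0 h0)
  have above: "\<bar>J\<bar> \<le> W * c powr (1 / q)" if c: "H / W < c" for c
  proof -
    have c0: "0 < c" using c H0 \<open>0 < W\<close>
      by (meson divide_nonneg_pos le_less_trans)
    let ?g = "\<lambda>t. c powr (1 / q) * ((1 - 1 / q) * w t + (1 / (q * c)) * (w t * h t))"
    have g: "(?g has_integral c powr (1 / q) * ((1 - 1 / q) * W + (1 / (q * c)) * H)) S"
      by (intro has_integral_mult_right has_integral_add w wh)
    have "\<bar>v t\<bar> \<le> ?g t" if t: "t \<in> S" for t
    proof -
      have "\<bar>v t\<bar> \<le> w t * h t powr (1 / q)" using le t .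
      also have "\<dots> \<le> w t * (c powr (1 / q) * (1 - 1 / q + h t / (q * c)))"
        by (intro mult_left_mono powr_inverse_le_tangent w0 h0 t c0 q)
      also have "\<dots> = ?g t" by (simp add: algebra_simps)
      finally show ?thesis .
    qed
    then have "norm (integral S v) \<le> integral S ?g"
      by (intro integral_norm_bound_integral has_integral_integrable[OF v]
          has_integral_integrable[OF g]) auto
    then have "\<bar>J\<bar> \<le> c powr (1 / q) * ((1 - 1 / q) * W + (1 / (q * c)) * H)"
      by (simp only: integral_unique[OF v] integral_unique[OF g] real_norm_def)
    also have "\<dots> \<le> c powr (1 / q) * W"
    proof (intro mult_left_mono)
      have "(1 / (q * c)) * H \<le> W / q"
        using c c0 \<open>0 < W\<close> q by (simp add: field_simps)
      then show "(1 - 1 / q) * W + (1 / (q * c)) * H \<le> W"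
        by (simp add: algebra_simps)
    qed simp
    finally show ?thesis by (simp add: mult.commute)
  qed
  have "((\<lambda>c. W * c powr (1 / q)) \<longlongrightarrow> W * (H / W) powr (1 / q)) (at_right (H / W))"
  proof (intro tendsto_mult tendsto_const tendsto_powr' tendsto_ident_at)
    have "0 \<le> H / W" using H0 \<open>0 < W\<close> by simp
    then have "\<forall>\<^sub>F c in at_right (H / W). 0 \<le> c"
      by (intro eventually_mono[OF eventually_at_right_less]) linarith
    then show "H / W \<noteq> 0 \<or> 0 < 1 / q \<and> (\<forall>\<^sub>F c in at_right (H / W). 0 \<le> c)"
      using q by simp
  qed
  moreover have "\<forall>\<^sub>F c in at_right (H / W). \<bar>J\<bar> \<le> W * c powr (1 / q)"
    using eventually_at_right_less[of "H / W"] by (rule eventually_mono) (rule above)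
  ultimately have "\<bar>J\<bar> \<le> W * (H / W) powr (1 / q)"
    by (rule tendsto_lowerbound) simp
  also have "\<dots> = W powr (1 - 1 / q) * H powr (1 / q)"
    using H0 \<open>0 < W\<close> by (simp add: powr_diff powr_divide)
  finally show ?thesis .
qed

section \<open>Integrals of the weights\<close>

text \<open>
  Integrals of \<open>\<bar>t - l\<bar> k(t)\<close> from an antiderivative \<open>K\<close> of \<open>(t - l) k(t)\<close>: the sign change at
  \<open>l\<close> counts the part to the left of \<open>l\<close> negatively.
\<close>
lemma has_integral_abs_diff_split:
  fixes k K :: "real \<Rightarrow> real"
  assumes K: "\<And>t. 0 \<le> t \<Longrightarrow> t \<le> u \<Longrightarrow> (K has_real_derivative (t - l) * k t) (at t)"
    and l: "0 \<le> l" "l \<le> u"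
  shows "((\<lambda>t. \<bar>t - l\<bar> * k t) has_integral K u - 2 * K l + K 0) {0..u}"
proof -
  have "((\<lambda>t. - ((t - l) * k t)) has_integral (- K l) - (- K 0)) {0..l}"
    using l K by (intro fundamental_theorem_of_calculus)
      (auto simp flip: has_real_derivative_iff_has_vector_derivative
        intro!: DERIV_minus intro: has_field_derivative_at_within)
  then have 1: "((\<lambda>t. \<bar>t - l\<bar> * k t) has_integral (- K l) - (- K 0)) {0..l}"
    by (rule has_integral_eq[rotated]) (auto simp: algebra_simps)
  have "((\<lambda>t. (t - l) * k t) has_integral K u - K l) {l..u}"
    using l K by (intro fundamental_theorem_of_calculus)
      (auto simp flip: has_real_derivative_iff_has_vector_derivative
        intro: has_field_derivative_at_within)
  then have 2: "((\<lambda>t. \<bar>t - l\<bar> * k t) has_integral K u - K l) {l..u}"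
    by (rule has_integral_eq[rotated]) auto
  from has_integral_combine[OF l 1 2] show ?thesis by (simp add: algebra_simps)
qed

lemma has_integral_abs_diff_left:
  fixes k K :: "real \<Rightarrow> real"
  assumes K: "\<And>t. 0 \<le> t \<Longrightarrow> t \<le> u \<Longrightarrow> (K has_real_derivative (t - l) * k t) (at t)"
    and u: "0 \<le> u" "u \<le> l"
  shows "((\<lambda>t. \<bar>t - l\<bar> * k t) has_integral K 0 - K u) {0..u}"
proof -
  have "((\<lambda>t. - ((t - l) * k t)) has_integral (- K u) - (- K 0)) {0..u}"
    using u K by (intro fundamental_theorem_of_calculus)
      (auto simp flip: has_real_derivative_iff_has_vector_derivative
        intro!: DERIV_minus intro: has_field_derivative_at_within)
  then have "((\<lambda>t. \<bar>t - l\<bar> * k t) has_integral (- K u) - (- K 0)) {0..u}"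
    by (rule has_integral_eq[rotated]) (use u in \<open>auto simp: algebra_simps\<close>)
  then show ?thesis by simp
qed

lemma DERIV_kernel:
  "((\<lambda>t. t ^ 3 / 3 - l * t\<^sup>2 / 2) has_real_derivative (t - l) * t) (at t)"
  by (auto intro!: derivative_eq_intros simp: power2_eq_square algebra_simps)

lemma DERIV_kernel_over_t:
  "((\<lambda>t. t\<^sup>2 / 2 - l * t) has_real_derivative (t - l) * 1) (at t)"
  by (auto intro!: derivative_eq_intros)

text \<open>Polynomial division gives \<open>(t - l) t / (1 - t) = - t - (1 - l) + (1 - l) / (1 - t)\<close>.\<close>
lemma DERIV_kernel_over_one_minus_t:
  assumes "t < 1"
  shows "((\<lambda>t. - t\<^sup>2 / 2 - (1 - l) * t - (1 - l) * ln (1 - t)) has_real_derivative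
    (t - l) * (t / (1 - t))) (at t)"
  using assms by (auto intro!: derivative_eq_intros) (simp add: divide_simps, algebra)

section \<open>The integral identity and the estimate\<close>

text \<open>
  Two integrations by parts leave the integral of \<open>f\<close>, since the quadratic \<open>t (t - l)\<close> has constant second
  derivative \<open>2\<close>. An antiderivative \<open>F\<close> of \<open>f\<close> absorbs it, so that the integrand has an
  explicit antiderivative. Taking \<open>x\<close>, \<open>y\<close> in either
  order covers both halves of the interval.
\<close>
lemma half_kernel_has_integral:
  fixes f f' f'' :: "real \<Rightarrow> real"
  assumes xy: "x \<in> {a..b}" "y \<in> {a..b}" "x \<noteq> y"
    and f: "\<And>z. z \<in> {a..b} \<Longrightarrow> (f has_real_derivative f' z) (at z)"
    and f': "\<And>z. z \<in> {a..b} \<Longrightarrow> (f' has_real_derivative f'' z) (at z)"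
    and F: "\<And>z. z \<in> {a..b} \<Longrightarrow> (F has_real_derivative f z) (at z within {a..b})"
  shows "((\<lambda>t. t * (t - l) * f'' (t * x + (1 - t) * y)) has_integral
    ((1 / 4 - l / 2) * (x - y) * f' ((x + y) / 2) - (1 - l) * f ((x + y) / 2) - l * f y
      + 2 * (F ((x + y) / 2) - F y) / (x - y)) / (x - y)\<^sup>2) {0..1 / 2}"
proof -
  let ?z = "\<lambda>t. t * x + (1 - t) * y"
  let ?A = "\<lambda>t. t * (t - l) * (x - y) * f' (?z t) - (2 * t - l) * f (?z t)
    + 2 * F (?z t) / (x - y)"
  have z: "?z t \<in> {a..b}" if "t \<in> {0..1 / 2}" for t
    using convexD[OF convex_real_interval(5)[of a b] xy(1,2), of t "1 - t"] that by auto
  have dz: "(?z has_real_derivative x - y) (at t within {0..1 / 2})" for t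
    by (auto intro!: derivative_eq_intros)
  have "((\<lambda>t. ?A t / (x - y)\<^sup>2) has_real_derivative t * (t - l) * f'' (?z t))
    (at t within {0..1 / 2})" if t: "t \<in> {0..1 / 2}" for t
  proof -
    note df = DERIV_chain2[OF f[OF z[OF t]] dz[of t]]
    note df' = DERIV_chain2[OF f'[OF z[OF t]] dz[of t]]
    have "(F has_real_derivative f (?z t)) (at (?z t) within ?z ` {0..1 / 2})"
      by (rule has_field_derivative_subset[OF F[OF z[OF t]]]) (use z in blast)
    note dF = DERIV_image_chain[OF this dz[of t], unfolded comp_def]
    have "(?A has_real_derivative t * (t - l) * f'' (?z t) * (x - y)\<^sup>2) (at t within {0..1 / 2})"
      using \<open>x \<noteq> y\<close>
      by (auto intro!: derivative_eq_intros df df' dF)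
        (simp add: power2_eq_square algebra_simps)
    from DERIV_cdivide[OF this, of "(x - y)\<^sup>2"] show ?thesis
      using \<open>x \<noteq> y\<close> by simp
  qed
  then have "((\<lambda>t. t * (t - l) * f'' (?z t)) has_integral
      ?A (1 / 2) / (x - y)\<^sup>2 - ?A 0 / (x - y)\<^sup>2) {0..1 / 2}"
    by (intro fundamental_theorem_of_calculus)
      (auto simp flip: has_real_derivative_iff_has_vector_derivative)
  moreover have "?z (1 / 2) = (x + y) / 2" by (simp add: field_simps)
  moreover have "?A (1 / 2) / (x - y)\<^sup>2 - ?A 0 / (x - y)\<^sup>2 =
    ((1 / 4 - l / 2) * (x - y) * f' (?z (1 / 2)) - (1 - l) * f (?z (1 / 2)) - l * f y
      + 2 * (F (?z (1 / 2)) - F y) / (x - y)) / (x - y)\<^sup>2"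
    unfolding diff_divide_distrib[symmetric]
    by (rule arg_cong[where f = "\<lambda>u. u / (x - y)\<^sup>2"]) (simp add: diff_divide_distrib algebra_simps)
  ultimately show ?thesis by (simp only:)
qed

lemma godunova_levin_segment:
  assumes "g \<in> godunova_levin I" "x \<in> I" "y \<in> I" "0 \<le> t" "t < 1"
  shows "g (t * x + (1 - t) * y) \<le> g x / t + g y / (1 - t)"
proof (cases "t = 0")
  case False
  then show ?thesis using assms by (auto simp: godunova_levin_def)
qed simp

text \<open>
  The Godunova-Levin bound fed into the power mean inequality. The constants \<open>W\<close>, \<open>P\<close> and \<open>R\<close> are
  kept abstract because their closed forms depend on the position of \<open>l\<close> relative to \<open>1 / 2\<close>.
\<close>
lemma half_kernel_bound:
  fixes f'' :: "real \<Rightarrow> real"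
  assumes J: "((\<lambda>t. t * (t - l) * f'' (t * x + (1 - t) * y)) has_integral J) {0..1 / 2}"
    and gl: "(\<lambda>z. \<bar>f'' z\<bar> powr q) \<in> godunova_levin I" and xy: "x \<in> I" "y \<in> I" and q: "1 \<le> q"
    and W: "((\<lambda>t. \<bar>t - l\<bar> * t) has_integral W) {0..1 / 2}" and "0 < W"
    and P: "((\<lambda>t. \<bar>t - l\<bar> * 1) has_integral P) {0..1 / 2}"
    and R: "((\<lambda>t. \<bar>t - l\<bar> * (t / (1 - t))) has_integral R) {0..1 / 2}"
  shows "\<bar>J\<bar> \<le> W powr (1 - 1 / q) * (P * \<bar>f'' x\<bar> powr q + R * \<bar>f'' y\<bar> powr q) powr (1 / q)"
proof (rule power_mean_bound[OF J W \<open>0 < W\<close> _ q])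
  let ?h = "\<lambda>t. \<bar>f'' x\<bar> powr q / t + \<bar>f'' y\<bar> powr q / (1 - t)"
  have "((\<lambda>t. \<bar>t - l\<bar> * 1 * \<bar>f'' x\<bar> powr q + \<bar>t - l\<bar> * (t / (1 - t)) * \<bar>f'' y\<bar> powr q)
      has_integral P * \<bar>f'' x\<bar> powr q + R * \<bar>f'' y\<bar> powr q) {0..1 / 2}"
    by (intro has_integral_add has_integral_mult_left P R)
  \<comment> \<open>The cancellation \<open>t * (1 / t) = 1\<close> fails at \<open>0\<close>, a single point.\<close>
  then show "((\<lambda>t. \<bar>t - l\<bar> * t * ?h t) has_integral
      P * \<bar>f'' x\<bar> powr q + R * \<bar>f'' y\<bar> powr q) {0..1 / 2}"
    by (rule has_integral_spike_finite[of "{0}", rotated 2]) (auto simp: field_simps)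
  fix t :: real
  assume t: "t \<in> {0..1 / 2}"
  then show "0 \<le> \<bar>t - l\<bar> * t" "0 \<le> ?h t" by auto
  let ?u = "\<bar>f'' (t * x + (1 - t) * y)\<bar>"
  have "?u powr q \<le> ?h t"
    using godunova_levin_segment[OF gl xy, of t] t by auto
  then have "(?u powr q) powr (1 / q) \<le> ?h t powr (1 / q)"
    using q by (intro powr_mono2) auto
  then have "?u \<le> ?h t powr (1 / q)"
    using q by (simp add: powr_powr)
  then have "\<bar>t - l\<bar> * t * ?u \<le> \<bar>t - l\<bar> * t * ?h t powr (1 / q)"
    using t by (intro mult_left_mono) auto
  then show "\<bar>t * (t - l) * f'' (t * x + (1 - t) * y)\<bar> \<le> \<bar>t - l\<bar> * t * ?h t powr (1 / q)"
    using t by (simp add: abs_mult mult_ac)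
qed

text \<open>
  Adding the identities for \<open>J a b\<close> and \<open>J b a\<close> cancels the terms with \<open>f'\<close> at the midpoint, whose sign
  depends on the order of \<open>a\<close> and \<open>b\<close>.
\<close>
lemma midpoint_trapezoid_bound:
  fixes f f' f'' :: "real \<Rightarrow> real"
  assumes "is_interval I" and ab: "a \<in> I" "b \<in> I" "a < b"
    and f: "\<And>x. x \<in> I \<Longrightarrow> (f has_real_derivative f' x) (at x)"
    and f': "\<And>x. x \<in> I \<Longrightarrow> (f' has_real_derivative f'' x) (at x)"
    and q: "1 \<le> q" and gl: "(\<lambda>x. \<bar>f'' x\<bar> powr q) \<in> godunova_levin I"
    and W: "((\<lambda>t. \<bar>t - l\<bar> * t) has_integral W) {0..1 / 2}" and W0: "0 < W"
    and P: "((\<lambda>t. \<bar>t - l\<bar> * 1) has_integral P) {0..1 / 2}"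
    and R: "((\<lambda>t. \<bar>t - l\<bar> * (t / (1 - t))) has_integral R) {0..1 / 2}"
  shows "\<bar>(l - 1) * f ((a + b) / 2) - l * ((f a + f b) / 2) + 1 / (b - a) * integral {a..b} f\<bar>
    \<le> (b - a)\<^sup>2 / 2 * W powr (1 - 1 / q) *
      ((P * \<bar>f'' a\<bar> powr q + R * \<bar>f'' b\<bar> powr q) powr (1 / q)
        + (R * \<bar>f'' a\<bar> powr q + P * \<bar>f'' b\<bar> powr q) powr (1 / q))" (is "\<bar>?E\<bar> \<le> _")
proof -
  have sub: "z \<in> I" if "z \<in> {a..b}" for z
    using that ab mem_is_interval_1_I[OF \<open>is_interval I\<close>, of a b z] by simp
  have cont: "continuous_on {a..b} f"
    by (intro continuous_at_imp_continuous_on ballI DERIV_isCont[OF f] sub)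
  define F where "F = (\<lambda>z. integral {a..z} f)"
  have F: "(F has_real_derivative f z) (at z within {a..b})" if "z \<in> {a..b}" for z
    unfolding F_def using integral_has_real_derivative[OF cont that] .
  define J where "J x y = ((1 / 4 - l / 2) * (x - y) * f' ((x + y) / 2)
    - (1 - l) * f ((x + y) / 2) - l * f y + 2 * (F ((x + y) / 2) - F y) / (x - y)) / (x - y)\<^sup>2" for x y
  have J: "((\<lambda>t. t * (t - l) * f'' (t * x + (1 - t) * y)) has_integral J x y) {0..1 / 2}"
    if "x \<in> {a..b}" "y \<in> {a..b}" "x \<noteq> y" for x y
    unfolding J_def using that f f' F sub by (intro half_kernel_has_integral) auto
  note bound = half_kernel_bound[OF J gl _ _ q W W0 P R]
  have Jab: "\<bar>J a b\<bar> \<le> W powr (1 - 1 / q) * (P * \<bar>f'' a\<bar> powr q + R * \<bar>f'' b\<bar> powr q) powr (1 / q)"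
    by (rule bound) (use ab in auto)
  have Jba: "\<bar>J b a\<bar> \<le> W powr (1 - 1 / q) * (R * \<bar>f'' a\<bar> powr q + P * \<bar>f'' b\<bar> powr q) powr (1 / q)"
    using bound[of b a] ab by (simp add: add.commute)
  have Fa: "F a = 0" and Fb: "F b = integral {a..b} f" by (simp_all add: F_def)
  define u where "u = 1 / (b - a)"
  have "2 * (F ((a + b) / 2) - F b) / (a - b) = 2 * (F b - F ((a + b) / 2)) * u"
    unfolding u_def using ab by (simp add: divide_simps) (simp add: algebra_simps)
  then have "(b - a)\<^sup>2 * J a b = (1 / 4 - l / 2) * (a - b) * f' ((a + b) / 2)
    - (1 - l) * f ((a + b) / 2) - l * f b + 2 * (F b - F ((a + b) / 2)) * u"
    unfolding J_def power2_commute[of a b] using ab by simp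
  moreover have "(b - a)\<^sup>2 * J b a = (1 / 4 - l / 2) * (b - a) * f' ((a + b) / 2)
    - (1 - l) * f ((a + b) / 2) - l * f a + 2 * (F ((a + b) / 2) - F a) * u"
    unfolding J_def u_def add.commute[of b a] using ab by simp
  ultimately have "(b - a)\<^sup>2 * (J a b + J b a) = 2 * ?E"
    unfolding distrib_left u_def[symmetric] Fa Fb[symmetric] by (simp add: field_simps)
  then have "?E = (b - a)\<^sup>2 / 2 * (J a b + J b a)"
    by simp
  then have "\<bar>?E\<bar> = (b - a)\<^sup>2 / 2 * \<bar>J a b + J b a\<bar>"
    by (simp only: abs_mult abs_divide abs_power2 abs_numeral)
  also have "\<dots> \<le> (b - a)\<^sup>2 / 2 * (\<bar>J a b\<bar> + \<bar>J b a\<bar>)"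
    by (intro mult_left_mono) auto
  also have "\<dots> \<le> (b - a)\<^sup>2 / 2 * (W powr (1 - 1 / q) *
      ((P * \<bar>f'' a\<bar> powr q + R * \<bar>f'' b\<bar> powr q) powr (1 / q)
        + (R * \<bar>f'' a\<bar> powr q + P * \<bar>f'' b\<bar> powr q) powr (1 / q)))"
    using Jab Jba by (intro mult_left_mono) (auto simp: distrib_left)
  finally show ?thesis by (simp add: mult.assoc)
qed

theorem theorem3:
  fixes I :: "real set" and f f' f'' :: "real \<Rightarrow> real" and a b q l :: real
  assumes "open I" and "is_interval I"
    and "a \<in> I" and "b \<in> I" and "a < b"
    and "\<And>x. x \<in> I \<Longrightarrow> (f has_real_derivative f' x) (at x)"
    and "\<And>x. x \<in> I \<Longrightarrow> (f' has_real_derivative f'' x) (at x)"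
    and "f'' absolutely_integrable_on I"
    and "1 \<le> q" and "0 \<le> l" and "l \<le> 1"
    and "(\<lambda>x. \<bar>f'' x\<bar> powr q) \<in> godunova_levin I"
  shows
    "(l \<le> 1 / 2 \<longrightarrow>
       \<bar>(l - 1) * f ((a + b) / 2) - l * ((f a + f b) / 2) + 1 / (b - a) * integral {a..b} f\<bar>
       \<le> (b - a)^2 / 2 * (l^3 / 3 + (1 - 3 * l) / 24) powr (1 - 1 / q) *
         (((l^2 - (4 * l - 1) / 8) * \<bar>f'' a\<bar> powr q
            + (ln ((2 * (1 - l)^2) powr (1 - l)) + (20 * l - 8 * l^2 - 5) / 8) * \<bar>f'' b\<bar> powr q)
              powr (1 / q)
          + ((ln ((2 * (1 - l)^2) powr (1 - l)) + (20 * l - 8 * l^2 - 5) / 8) * \<bar>f'' a\<bar> powr q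
            + (l^2 - (4 * l - 1) / 8) * \<bar>f'' b\<bar> powr q)
              powr (1 / q)))
     \<and>
     (1 / 2 \<le> l \<longrightarrow>
       \<bar>(l - 1) * f ((a + b) / 2) - l * ((f a + f b) / 2) + 1 / (b - a) * integral {a..b} f\<bar>
       \<le> (b - a)^2 / 2 * ((3 * l - 1) / 24) powr (1 - 1 / q) *
         (((4 * l - 1) / 8 * \<bar>f'' a\<bar> powr q
            + ((5 - 4 * l) / 8 - (l - 1) * ln (1 / 2)) * \<bar>f'' b\<bar> powr q)
              powr (1 / q)
          + (((5 - 4 * l) / 8 - (l - 1) * ln (1 / 2)) * \<bar>f'' a\<bar> powr q
            + (4 * l - 1) / 8 * \<bar>f'' b\<bar> powr q)
              powr (1 / q)))"
proof (intro conjI impI, goal_cases)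
  case l: 1
  note split = has_integral_abs_diff_split[OF _ \<open>0 \<le> l\<close> l]
  have W: "((\<lambda>t. \<bar>t - l\<bar> * t) has_integral l ^ 3 / 3 + (1 - 3 * l) / 24) {0..1 / 2}"
    by (rule has_integral_eq_rhs[OF split[OF DERIV_kernel]])
      (simp_all add: power2_eq_square power3_eq_cube field_simps)
  \<comment> \<open>\<open>l\<^sup>3\<close> lies above its tangent at \<open>1 / 3\<close>, a rational point near the minimum \<open>1 / sqrt 8\<close> of \<open>W\<close>.\<close>
  have "0 \<le> (l - 1 / 3)\<^sup>2 * (l + 2 / 3)"
    using \<open>0 \<le> l\<close> by simp
  also have "\<dots> = l ^ 3 - l / 3 + 2 / 27"
    by (simp add: power2_eq_square power3_eq_cube field_simps)
  finally have "0 < (l ^ 3 - l / 3 + 2 / 27) / 3 + (11 / 648 - l / 72)"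
    using l by (intro add_nonneg_pos) simp_all
  then have W0: "0 < l ^ 3 / 3 + (1 - 3 * l) / 24"
    by (simp add: field_simps)
  have P: "((\<lambda>t. \<bar>t - l\<bar> * 1) has_integral l\<^sup>2 - (4 * l - 1) / 8) {0..1 / 2}"
    by (rule has_integral_eq_rhs[OF split[OF DERIV_kernel_over_t]])
      (simp_all add: power2_eq_square field_simps)
  have "ln ((2 * (1 - l)\<^sup>2) powr (1 - l)) = (1 - l) * (ln 2 + 2 * ln (1 - l))"
    using l by (simp add: ln_powr ln_mult ln_realpow)
  then have R: "((\<lambda>t. \<bar>t - l\<bar> * (t / (1 - t))) has_integral
      ln ((2 * (1 - l)\<^sup>2) powr (1 - l)) + (20 * l - 8 * l\<^sup>2 - 5) / 8) {0..1 / 2}"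
    using l by (intro has_integral_eq_rhs[OF split[OF DERIV_kernel_over_one_minus_t]])
      (simp_all add: power2_eq_square ln_div field_simps)
  show ?case
    by (rule midpoint_trapezoid_bound[OF assms(2-7,9,12) W W0 P R])
next
  case l: 2
  note left = has_integral_abs_diff_left[OF _ _ l]
  have W: "((\<lambda>t. \<bar>t - l\<bar> * t) has_integral (3 * l - 1) / 24) {0..1 / 2}"
    by (rule has_integral_eq_rhs[OF left[OF DERIV_kernel]])
      (simp_all add: power2_eq_square power3_eq_cube field_simps)
  have W0: "0 < (3 * l - 1) / 24" using l by simp
  have P: "((\<lambda>t. \<bar>t - l\<bar> * 1) has_integral (4 * l - 1) / 8) {0..1 / 2}"
    by (rule has_integral_eq_rhs[OF left[OF DERIV_kernel_over_t]])
      (simp_all add: power2_eq_square field_simps)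
  have R: "((\<lambda>t. \<bar>t - l\<bar> * (t / (1 - t))) has_integral
      (5 - 4 * l) / 8 - (l - 1) * ln (1 / 2)) {0..1 / 2}"
    by (rule has_integral_eq_rhs[OF left[OF DERIV_kernel_over_one_minus_t]])
      (simp_all add: power2_eq_square field_simps)
  show ?case
    by (rule midpoint_trapezoid_bound[OF assms(2-7,9,12) W W0 P R])
qed

end
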